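(* For every finite, simple, connected graph $G$, \[ L(G) \le \dim(G) \le L(G) + 6\,c(G). \]
   Context: All graphs are finite, simple, undirected and connected; $d(u,v)$ is the shortest-path distance. A vertex $w$ resolves a pair $(u,v)$ if $d(w,u)\neq d(w,v)$. A set $S\subseteq V(G)$ is a resolving set if every pair of distinct vertices is resolved by some vertex of $S$. The metric dimension $\dim(G)$ is the minimum size of a resolving set. The cycle rank is $c(G)=|E(G)|-|V(G)|+1$ for connected $G$, i.e. the minimum number of edges whose deletion leaves a forest. A terminal vertex is a vertex of degree $1$; a major vertex is a vertex of degree at least $3$. A terminal vertex $u$ is a terminal vertex of the major vertex $v$ if $d(u,v)<d(u,w)$ for every other major vertex $w$. The terminal degree $\mathrm{ter}(v)$ of a major vertex $v$ is its number of terminal vertices; $v$ is exterior if $\mathrm{ter}(v)>0$. Let $\sigma(G)$ be the sum of the terminal degrees of all major vertices and $ex(G)$ the number of exterior major vertices. Then $L(G)=\sigma(G)-ex(G)$, except that $L(G)=1$ if $G$ is a path $P_n$ ($n\ge 1$).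
   Formalization: The exception L(G)=1 is applied only to paths with at least one edge; the one-vertex graph gets L=0, since its metric dimension is 0 (the empty set resolves it) and L=1 would violate the lower bound. *)

theory Defs
  imports Complex_Main
begin

definition simple_graph :: "'a set \<Rightarrow> 'a set set \<Rightarrow> bool" where
  "simple_graph V E \<longleftrightarrow> finite V \<and> (\<forall>e\<in>E. e \<subseteq> V \<and> card e = 2)"

definition walk :: "'a set \<Rightarrow> 'a set set \<Rightarrow> 'a list \<Rightarrow> bool" where
  "walk V E xs \<longleftrightarrow> xs \<noteq> [] \<and> set xs \<subseteq> V \<and> successively (\<lambda>x y. {x, y} \<in> E) xs"

definition walk_between :: "'a set \<Rightarrow> 'a set set \<Rightarrow> 'a \<Rightarrow> 'a \<Rightarrow> nat \<Rightarrow> bool" where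
  "walk_between V E u v n \<longleftrightarrow>
     (\<exists>xs. walk V E xs \<and> hd xs = u \<and> last xs = v \<and> length xs = Suc n)"

definition connected_graph :: "'a set \<Rightarrow> 'a set set \<Rightarrow> bool" where
  "connected_graph V E \<longleftrightarrow> V \<noteq> {} \<and> (\<forall>u\<in>V. \<forall>v\<in>V. \<exists>n. walk_between V E u v n)"

definition gdist :: "'a set \<Rightarrow> 'a set set \<Rightarrow> 'a \<Rightarrow> 'a \<Rightarrow> nat" where
  "gdist V E u v = (LEAST n. walk_between V E u v n)"

definition resolves :: "'a set \<Rightarrow> 'a set set \<Rightarrow> 'a \<Rightarrow> 'a \<Rightarrow> 'a \<Rightarrow> bool" where
  "resolves V E w u v \<longleftrightarrow> gdist V E w u \<noteq> gdist V E w v"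

definition resolving_set :: "'a set \<Rightarrow> 'a set set \<Rightarrow> 'a set \<Rightarrow> bool" where
  "resolving_set V E S \<longleftrightarrow>
     S \<subseteq> V \<and> (\<forall>u\<in>V. \<forall>v\<in>V. u \<noteq> v \<longrightarrow> (\<exists>w\<in>S. resolves V E w u v))"

definition metric_dim :: "'a set \<Rightarrow> 'a set set \<Rightarrow> nat" where
  "metric_dim V E = (LEAST k. \<exists>S. resolving_set V E S \<and> card S = k)"

definition cycle_rank :: "'a set \<Rightarrow> 'a set set \<Rightarrow> int" where
  "cycle_rank V E = int (card E) - int (card V) + 1"

definition degree :: "'a set set \<Rightarrow> 'a \<Rightarrow> nat" where
  "degree E v = card {e \<in> E. v \<in> e}"

definition terminal_vertices :: "'a set \<Rightarrow> 'a set set \<Rightarrow> 'a set" where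
  "terminal_vertices V E = {v \<in> V. degree E v = 1}"

definition major_vertices :: "'a set \<Rightarrow> 'a set set \<Rightarrow> 'a set" where
  "major_vertices V E = {v \<in> V. degree E v \<ge> 3}"

definition terminal_vertices_of :: "'a set \<Rightarrow> 'a set set \<Rightarrow> 'a \<Rightarrow> 'a set" where
  "terminal_vertices_of V E v =
     {u \<in> terminal_vertices V E.
        \<forall>w\<in>major_vertices V E. w \<noteq> v \<longrightarrow> gdist V E u v < gdist V E u w}"

definition ter :: "'a set \<Rightarrow> 'a set set \<Rightarrow> 'a \<Rightarrow> nat" where
  "ter V E v = card (terminal_vertices_of V E v)"

definition exterior_major_vertices :: "'a set \<Rightarrow> 'a set set \<Rightarrow> 'a set" where
  "exterior_major_vertices V E = {v \<in> major_vertices V E. ter V E v > 0}"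

definition sigma :: "'a set \<Rightarrow> 'a set set \<Rightarrow> nat" where
  "sigma V E = (\<Sum>v\<in>major_vertices V E. ter V E v)"

definition ex :: "'a set \<Rightarrow> 'a set set \<Rightarrow> nat" where
  "ex V E = card (exterior_major_vertices V E)"

text \<open>The graph is a path \<open>P\<^sub>n\<close>, where \<open>n\<close> is the length, i.e. the number of edges.\<close>

definition path_graph :: "nat \<Rightarrow> 'a set \<Rightarrow> 'a set set \<Rightarrow> bool" where
  "path_graph n V E \<longleftrightarrow>
     (\<exists>xs. distinct xs \<and> length xs = Suc n \<and> set xs = V \<and>
           E = {{xs ! i, xs ! Suc i} | i. i < n})"

text \<open>The exception is for paths with at least one edge. The one-vertex graph, whose metric
  dimension is \<open>0\<close> (the empty set resolves it), falls under the general formula and has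
  value \<open>0\<close>; with value \<open>1\<close> the lower bound \<open>L \<le> dim\<close> would fail for it.\<close>

definition L :: "'a set \<Rightarrow> 'a set set \<Rightarrow> int" where
  "L V E = (if \<exists>n\<ge>1. path_graph n V E then 1 else int (sigma V E) - int (ex V E))"

end

theory Submission
  imports Defs
begin

text \<open>
  Lower bound: for each terminal vertex \<open>u\<close> of a major vertex \<open>v\<close>, the vertices closer to \<open>u\<close>
  than \<open>v\<close> form a leg attached to \<open>v\<close> by a single edge. Legs are disjoint, and a resolving set meets all
  but at most one leg of each \<open>v\<close>, because otherwise two neighbours of \<open>v\<close> are not resolved.

  Upper bound: take all terminal vertices but one for each exterior major vertex. Fix a breadth-first
  tree with root \<open>r\<close>; it misses exactly \<open>c(G)\<close> edges. The ancestors of the ends of these edges form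
  a subtree, the skeleton; add the root, the ends and the branching vertices of the skeleton, at
  most \<open>1 + 4 c(G)\<close> landmarks. The landmarks separate skeleton vertices doubly (the difference of the
  distances to two distinct skeleton vertices is not constant on the landmarks), hence also vertices
  hanging off distinct skeleton vertices. Two vertices of equal depth in the same hanging tree are
  resolved by the chosen terminal vertices, since every branch of a hanging tree without a chosen
  vertex is a path to a terminal vertex of the branching point. For \<open>c(G) = 0\<close> the root itself can
  be taken among the chosen terminal vertices, unless there are none, and then \<open>G\<close> is a path.
\<close>

lemma finite_has_max:
  fixes f :: "'b \<Rightarrow> nat"
  assumes "finite A" "A \<noteq> {}"
  obtains m where "m \<in> A" "\<And>x. x \<in> A \<Longrightarrow> f x \<le> f m"
proof -
  have "Max (f ` A) \<in> f ` A" using assms by (intro Max_in) auto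
  then obtain m where "m \<in> A" "Max (f ` A) = f m" by auto
  then show thesis using that[of m] Max_ge[of "f ` A"] assms(1) by (metis finite_imageI imageI)
qed

section \<open>Distances\<close>

locale conn_graph =
  fixes V :: "'a set" and E :: "'a set set"
  assumes simple: "simple_graph V E" and conn: "connected_graph V E"
begin

abbreviation d :: "'a \<Rightarrow> 'a \<Rightarrow> nat" where "d \<equiv> gdist V E"

lemma finite_V [simp]: "finite V"
  using simple by (simp add: simple_graph_def)

lemma V_nonempty: "V \<noteq> {}"
  using conn by (simp add: connected_graph_def)

lemma edge_card: "e \<in> E \<Longrightarrow> card e = 2"
  using simple by (simp add: simple_graph_def)

lemma edge_subset: "e \<in> E \<Longrightarrow> e \<subseteq> V"
  using simple by (simp add: simple_graph_def)

lemma finite_E [simp]: "finite E"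
  by (rule finite_subset[of _ "Pow V"]) (auto dest: edge_subset)

lemma edge_in_V: "{x, y} \<in> E \<Longrightarrow> x \<in> V" "{x, y} \<in> E \<Longrightarrow> y \<in> V"
  using edge_subset by auto

lemma edge_neq: "{x, y} \<in> E \<Longrightarrow> x \<noteq> y"
  using edge_card by force

lemma edge_sym: "{x, y} \<in> E \<Longrightarrow> {y, x} \<in> E"
  by (simp add: insert_commute)

lemma edge_elim:
  assumes "e \<in> E" "x \<in> e"
  obtains y where "e = {x, y}"
proof -
  obtain a b where "e = {a, b}"
    using edge_card[OF assms(1)] by (auto simp: card_2_iff)
  with assms(2) that show thesis
    by (metis insert_commute insert_iff singletonD)
qed

lemma walk_between_0 [simp]: "walk_between V E u v 0 \<longleftrightarrow> u = v \<and> u \<in> V"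
proof
  assume "walk_between V E u v 0"
  then show "u = v \<and> u \<in> V"
    by (auto simp: walk_between_def walk_def length_Suc_conv)
next
  assume "u = v \<and> u \<in> V"
  then have "walk V E [u]" "hd [u] = u" "last [u] = v" "length [u] = Suc 0"
    by (auto simp: walk_def)
  then show "walk_between V E u v 0"
    unfolding walk_between_def by blast
qed

lemma walk_between_Suc:
  "walk_between V E u v (Suc n) \<longleftrightarrow> (\<exists>w. {u, w} \<in> E \<and> walk_between V E w v n)"
proof
  assume "walk_between V E u v (Suc n)"
  then obtain xs where xs: "walk V E xs" "hd xs = u" "last xs = v" "length xs = Suc (Suc n)"
    by (auto simp: walk_between_def)
  then obtain w ys where "xs = u # w # ys"
    by (auto simp: length_Suc_conv)
  with xs have "{u, w} \<in> E" "walk V E (w # ys)" "last (w # ys) = v" "length (w # ys) = Suc n"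
    by (auto simp: walk_def)
  then show "\<exists>w. {u, w} \<in> E \<and> walk_between V E w v n"
    unfolding walk_between_def by (metis list.sel(1))
next
  assume "\<exists>w. {u, w} \<in> E \<and> walk_between V E w v n"
  then obtain w xs where w: "{u, w} \<in> E" and
    xs: "walk V E xs" "hd xs = w" "last xs = v" "length xs = Suc n"
    by (auto simp: walk_between_def)
  have "walk V E (u # xs)" "last (u # xs) = v"
    using w xs edge_in_V(1)[OF w] by (auto simp: walk_def successively_Cons)
  then show "walk_between V E u v (Suc n)"
    using xs(4) unfolding walk_between_def by (metis length_Cons list.sel(1))
qed

lemma walk_between_trans:
  "walk_between V E u v n \<Longrightarrow> walk_between V E v w m \<Longrightarrow> walk_between V E u w (n + m)"
  by (induction n arbitrary: u) (auto simp: walk_between_Suc)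

lemma walk_between_edge: "{u, v} \<in> E \<Longrightarrow> walk_between V E u v (Suc 0)"
  by (auto simp: walk_between_Suc edge_in_V)

lemma walk_between_sym: "walk_between V E u v n \<Longrightarrow> walk_between V E v u n"
proof (induction n arbitrary: u)
  case (Suc n)
  then obtain w where "{u, w} \<in> E" "walk_between V E v w n"
    by (auto simp: walk_between_Suc)
  then show ?case
    using walk_between_trans[OF _ walk_between_edge[OF edge_sym]] by force
qed auto

lemma walk_between_gdist: "u \<in> V \<Longrightarrow> v \<in> V \<Longrightarrow> walk_between V E u v (d u v)"
  using conn unfolding connected_graph_def gdist_def by (blast intro: LeastI_ex)

lemma gdist_le: "walk_between V E u v n \<Longrightarrow> d u v \<le> n"
  unfolding gdist_def by (rule Least_le)

lemma gdist_refl [simp]: "u \<in> V \<Longrightarrow> d u u = 0"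
  using gdist_le[of u u 0] by simp

lemma gdist_eq_0: "u \<in> V \<Longrightarrow> v \<in> V \<Longrightarrow> d u v = 0 \<longleftrightarrow> u = v"
  using walk_between_gdist[of u v] by auto

lemma gdist_sym: "u \<in> V \<Longrightarrow> v \<in> V \<Longrightarrow> d u v = d v u"
  by (meson antisym gdist_le walk_between_gdist walk_between_sym)

lemma gdist_triangle: "u \<in> V \<Longrightarrow> v \<in> V \<Longrightarrow> w \<in> V \<Longrightarrow> d u w \<le> d u v + d v w"
  by (meson gdist_le walk_between_gdist walk_between_trans)

lemma gdist_edge: "{u, v} \<in> E \<Longrightarrow> d u v = 1"
  using gdist_le[OF walk_between_edge] gdist_eq_0[of u v] edge_in_V[of u v] edge_neq[of u v]
  by fastforce

lemma gdist_edge_le: "{u, v} \<in> E \<Longrightarrow> w \<in> V \<Longrightarrow> d w v \<le> d w u + 1"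
  using gdist_triangle[of w u v] gdist_edge[of u v] edge_in_V[of u v] by simp

lemma gdist_step:
  assumes "u \<in> V" "v \<in> V" "u \<noteq> v"
  obtains w where "{u, w} \<in> E" "d u v = d w v + 1"
proof -
  obtain n where n: "d u v = Suc n"
    using gdist_eq_0[OF assms(1,2)] assms(3) not0_implies_Suc by blast
  then obtain w where w: "{u, w} \<in> E" "walk_between V E w v n"
    using walk_between_gdist[OF assms(1,2)] by (auto simp: walk_between_Suc)
  have "d u v \<le> d w v + 1"
    using gdist_edge_le[OF edge_sym[OF w(1)] assms(2)] edge_in_V[OF w(1)] assms
    by (simp add: gdist_sym)
  then show thesis
    using that[OF w(1)] gdist_le[OF w(2)] n by simp
qed

lemma gdist_step_back:
  assumes "u \<in> V" "v \<in> V" "u \<noteq> v"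
  obtains w where "{w, v} \<in> E" "d u v = d u w + 1"
  using assms by (metis edge_in_V(2) edge_sym gdist_step gdist_sym)

lemma gdist_level_exists:
  assumes "u \<in> V" "v \<in> V" "k \<le> d u v"
  shows "\<exists>w\<in>V. d u w = k"
  using assms(2,3)
proof (induction "d u v" arbitrary: v)
  case 0
  then show ?case by auto
next
  case (Suc n)
  show ?case
  proof (cases "k = d u v")
    case False
    have "u \<noteq> v" using Suc assms(1) by auto
    then obtain w where w: "{w, v} \<in> E" "d u v = d u w + 1"
      using gdist_step_back[OF assms(1) Suc.prems(1)] by metis
    then show ?thesis
      using Suc False edge_in_V(1)[OF w(1)] by auto
  qed (use Suc.prems in blast)
qed

lemma gdist_lipschitz:
  fixes f :: "'a \<Rightarrow> nat"
  assumes "\<And>x y. {x, y} \<in> E \<Longrightarrow> f x \<le> f y + 1" "u \<in> V" "v \<in> V"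
  shows "f u \<le> f v + d u v"
  using assms(2)
proof (induction "d u v" arbitrary: u)
  case 0
  then show ?case using gdist_eq_0 assms(3) by simp
next
  case (Suc n)
  then have "u \<noteq> v" using assms(3) by auto
  then obtain w where w: "{u, w} \<in> E" "d u v = d w v + 1"
    using gdist_step Suc.prems assms(3) by blast
  then have "f w \<le> f v + d w v"
    using Suc edge_in_V(2) by simp
  then show ?case using assms(1)[OF w(1)] w(2) by simp
qed

lemma gdist_bridge:
  assumes bridge: "{p, w} \<in> E" "w \<in> D" "p \<notin> D"
    and cut: "\<And>x y. {x, y} \<in> E \<Longrightarrow> x \<in> D \<Longrightarrow> y \<notin> D \<Longrightarrow> x = w \<and> y = p"
    and "z \<in> V" "z \<notin> D" "t \<in> V" "t \<in> D"
  shows "d z t = d z p + 1 + d w t"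
proof (rule antisym)
  have "p \<in> V" "w \<in> V" using edge_in_V bridge(1) by auto
  then show "d z t \<le> d z p + 1 + d w t"
    using gdist_triangle[of z p t] gdist_triangle[of p w t] gdist_edge[OF bridge(1)] assms by simp
  show "d z p + 1 + d w t \<le> d z t"
    using \<open>z \<in> V\<close> \<open>z \<notin> D\<close>
  proof (induction "d z t" arbitrary: z)
    case 0
    then show ?case using gdist_eq_0 assms by metis
  next
    case (Suc n)
    then obtain z' where z': "{z, z'} \<in> E" "d z t = d z' t + 1"
      using gdist_step[of z t] assms by metis
    show ?case
    proof (cases "z' \<in> D")
      case True
      then have "z' = w" "z = p"
        using cut[OF edge_sym[OF z'(1)]] Suc.prems by auto
      then show ?thesis using z'(2) \<open>p \<in> V\<close> by simp
    next
      case False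
      then have "d z' p + 1 + d w t \<le> d z' t"
        using Suc z' edge_in_V by simp
      moreover have "d z p \<le> d z' p + 1"
        using gdist_edge_le[OF edge_sym[OF z'(1)] \<open>p \<in> V\<close>] edge_in_V[OF z'(1)] \<open>p \<in> V\<close>
        by (simp add: gdist_sym)
      ultimately show ?thesis using z'(2) by simp
    qed
  qed
qed

lemma degree_ge_3:
  assumes "{a, x} \<in> E" "{a, y} \<in> E" "{a, z} \<in> E" "x \<noteq> y" "x \<noteq> z" "y \<noteq> z"
  shows "degree E a \<ge> 3"
proof -
  have "card {{a, x}, {a, y}, {a, z}} = 3"
    using assms by (auto simp: doubleton_eq_iff card_insert_if)
  moreover have "card {{a, x}, {a, y}, {a, z}} \<le> card {e \<in> E. a \<in> e}"
    by (rule card_mono) (use assms in auto)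
  ultimately show ?thesis by (simp add: degree_def)
qed

lemma degree_1_unique:
  assumes "degree E a = 1" "{a, x} \<in> E" "{a, y} \<in> E"
  shows "x = y"
proof -
  obtain e where "{e \<in> E. a \<in> e} = {e}"
    using assms(1) by (auto simp: degree_def card_1_singleton_iff)
  moreover have "{a, x} \<in> {e \<in> E. a \<in> e}" "{a, y} \<in> {e \<in> E. a \<in> e}"
    using assms(2,3) by auto
  ultimately have "{a, x} = {a, y}" by simp
  then show ?thesis by (metis doubleton_eq_iff)
qed

section \<open>Terminal vertices\<close>

abbreviation Maj :: "'a set" where "Maj \<equiv> major_vertices V E"
abbreviation Ext :: "'a set" where "Ext \<equiv> exterior_major_vertices V E"
abbreviation Ter :: "'a \<Rightarrow> 'a set" where "Ter \<equiv> terminal_vertices_of V E"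

lemma Maj_subset: "Maj \<subseteq> V" by (auto simp: major_vertices_def)

lemma Ext_subset: "Ext \<subseteq> Maj" by (auto simp: exterior_major_vertices_def)

lemma finite_Ext [simp]: "finite Ext"
  using Maj_subset Ext_subset finite_V by (metis finite_subset)

lemma Ter_subset: "Ter v \<subseteq> V"
  by (auto simp: terminal_vertices_of_def terminal_vertices_def)

lemma finite_Ter [simp]: "finite (Ter v)"
  using Ter_subset finite_V by (metis finite_subset)

lemma Ter_degree: "u \<in> Ter v \<Longrightarrow> degree E u = 1"
  by (auto simp: terminal_vertices_of_def terminal_vertices_def)

lemma Ter_closest: "u \<in> Ter v \<Longrightarrow> w \<in> Maj \<Longrightarrow> w \<noteq> v \<Longrightarrow> d u v < d u w"
  by (auto simp: terminal_vertices_of_def)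

lemma Ter_nonempty: "v \<in> Ext \<Longrightarrow> Ter v \<noteq> {}"
  by (auto simp: exterior_major_vertices_def ter_def)

lemma Ter_disjoint: "v \<in> Maj \<Longrightarrow> w \<in> Maj \<Longrightarrow> v \<noteq> w \<Longrightarrow> Ter v \<inter> Ter w = {}"
  using Ter_closest by (metis disjoint_iff less_asym)

lemma sigma_eq: "sigma V E = (\<Sum>v\<in>Ext. card (Ter v) - 1) + ex V E"
proof -
  have "sigma V E = (\<Sum>v\<in>Ext. card (Ter v))"
    unfolding sigma_def ter_def
    by (rule sum.mono_neutral_right)
      (use Maj_subset Ext_subset finite_V in
        \<open>auto simp: exterior_major_vertices_def ter_def intro: finite_subset\<close>)
  also have "\<dots> = (\<Sum>v\<in>Ext. (card (Ter v) - 1) + 1)"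
    by (rule sum.cong) (auto simp: exterior_major_vertices_def ter_def)
  also have "\<dots> = (\<Sum>v\<in>Ext. card (Ter v) - 1) + ex V E"
    by (simp only: sum.distrib ex_def) simp
  finally show ?thesis .
qed

definition leg :: "'a \<Rightarrow> 'a \<Rightarrow> 'a set" where
  "leg v u = {w \<in> V. d u w < d u v}"

lemma leg_level_unique:
  assumes v: "v \<in> Maj" and u: "u \<in> Ter v"
  shows "\<lbrakk>y \<in> V; z \<in> V; d u y = i; d u z = i; i \<le> d u v\<rbrakk> \<Longrightarrow> y = z"
proof (induction i arbitrary: y z)
  case 0
  then show ?case using gdist_eq_0 Ter_subset u by blast
next
  case (Suc i)
  have uV: "u \<in> V" using Ter_subset u by blast
  have "y \<noteq> u" "z \<noteq> u" using Suc.prems uV by auto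
  then obtain x x' where x: "{x, y} \<in> E" "d u y = d u x + 1" and x': "{x', z} \<in> E" "d u z = d u x' + 1"
    using gdist_step_back[OF uV] Suc.prems(1,2) by metis
  have "x = x'"
    using Suc.IH[of x x'] Suc.prems x x' edge_in_V by simp
  show ?case
  proof (rule ccontr)
    assume "y \<noteq> z"
    show False
    proof (cases "x = u")
      case True
      then show False
        using degree_1_unique[OF Ter_degree[OF u]] x x' \<open>x = x'\<close> \<open>y \<noteq> z\<close> by blast
    next
      case False
      then obtain w where w: "{w, x} \<in> E" "d u x = d u w + 1"
        using gdist_step_back[OF uV edge_in_V(1)[OF x(1)]] by metis
      have "degree E x \<ge> 3"
        by (rule degree_ge_3[of x w y z])
          (use w x x' \<open>x = x'\<close> \<open>y \<noteq> z\<close> edge_sym in auto)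
      then have "x \<in> Maj" using edge_in_V(1)[OF x(1)] by (simp add: major_vertices_def)
      moreover have "x \<noteq> v" using Suc.prems x by auto
      ultimately show False
        using Ter_closest[OF u] Suc.prems x by force
    qed
  qed
qed

lemma leg_neighbour:
  assumes v: "v \<in> Maj" and u: "u \<in> Ter v"
  obtains a where "{v, a} \<in> E" "a \<in> leg v u"
    "\<And>z t. z \<in> V \<Longrightarrow> z \<notin> leg v u \<Longrightarrow> t \<in> leg v u \<Longrightarrow> d z t = d z v + 1 + d a t"
proof -
  have uV: "u \<in> V" and vV: "v \<in> V" using Ter_subset u Maj_subset v by auto
  have "u \<noteq> v" using Ter_degree[OF u] v by (auto simp: major_vertices_def)
  then obtain a where a: "{a, v} \<in> E" "d u v = d u a + 1"
    using gdist_step_back[OF uV vV] by metis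
  have aV: "a \<in> V" using edge_in_V a by auto
  have "a \<in> leg v u" using a aV by (simp add: leg_def)
  moreover have "v \<notin> leg v u" by (simp add: leg_def)
  moreover have "x = a \<and> y = v" if "{x, y} \<in> E" "x \<in> leg v u" "y \<notin> leg v u" for x y
  proof -
    have "y \<in> V" "x \<in> V" using edge_in_V that by auto
    moreover have "d u y \<le> d u x + 1" using gdist_edge_le[OF that(1) uV] .
    ultimately have "d u y = d u v" "d u x = d u a"
      using that(2,3) a(2) by (auto simp: leg_def)
    then show ?thesis
      using leg_level_unique[OF v u, of y v] leg_level_unique[OF v u, of x a]
        \<open>y \<in> V\<close> \<open>x \<in> V\<close> vV aV a(2) by simp
  qed
  ultimately have "d z t = d z v + 1 + d a t" if "z \<in> V" "z \<notin> leg v u" "t \<in> leg v u" for z t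
    using gdist_bridge[OF edge_sym[OF a(1)], of "leg v u" z t] that by (auto simp: leg_def)
  then show thesis
    using that[of a] edge_sym[OF a(1)] \<open>a \<in> leg v u\<close> by blast
qed

lemma terminal_not_in_leg:
  assumes v: "v \<in> Maj" and u: "u \<in> Ter v" and u': "u' \<in> V" "degree E u' = 1" "u' \<noteq> u"
  shows "u' \<notin> leg v u"
proof
  assume leg: "u' \<in> leg v u"
  have uV: "u \<in> V" and vV: "v \<in> V" using Ter_subset u Maj_subset v by auto
  obtain w where w: "{w, u'} \<in> E" "d u u' = d u w + 1"
    using gdist_step_back[OF uV u'(1)] u'(3) by metis
  obtain y where y: "y \<in> V" "d u y = d u u' + 1"
    using gdist_level_exists[OF uV vV, of "d u u' + 1"] leg by (auto simp: leg_def)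
  then have "u \<noteq> y" using uV by auto
  then obtain x where x: "{x, y} \<in> E" "d u y = d u x + 1"
    using gdist_step_back[OF uV y(1)] by metis
  have "d u x = d u u'" using x(2) y(2) by simp
  then have "x = u'"
    using leg_level_unique[OF v u edge_in_V(1)[OF x(1)] u'(1)] leg by (simp add: leg_def)
  then have "y = w"
    using degree_1_unique[OF u'(2)] x(1) edge_sym[OF w(1)] by blast
  then show False using y w by simp
qed

lemma legs_disjoint:
  assumes "v \<in> Maj" "u \<in> Ter v" "v' \<in> Maj" "u' \<in> Ter v'" "u \<noteq> u'"
  shows "leg v u \<inter> leg v' u' = {}"
proof (rule ccontr)
  assume "leg v u \<inter> leg v' u' \<noteq> {}"
  then obtain w where w: "w \<in> leg v u" "w \<in> leg v' u'" by blast
  have u'V: "u' \<in> V" using Ter_subset assms by blast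
  have "u' \<notin> leg v u"
    using terminal_not_in_leg[OF assms(1,2) u'V Ter_degree[OF assms(4)]] assms(5) by simp
  then obtain a where "d u' w = d u' v + 1 + d a w"
    using leg_neighbour[OF assms(1,2)] u'V w(1) by metis
  then have "d u' v < d u' w" by simp
  moreover have "d u' v' \<le> d u' v"
    using Ter_closest[OF assms(4,1)] by (cases "v = v'") auto
  ultimately show False using w(2) by (simp add: leg_def)
qed

lemma resolving_set_hits_legs:
  assumes S: "resolving_set V E S" and v: "v \<in> Maj"
  shows "card (Ter v) - 1 \<le> card {u \<in> Ter v. S \<inter> leg v u \<noteq> {}}"
proof -
  have "u = u'" if u: "u \<in> Ter v" "S \<inter> leg v u = {}" and u': "u' \<in> Ter v" "S \<inter> leg v u' = {}" for u u'
  proof (rule ccontr)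
    assume "u \<noteq> u'"
    obtain a where a: "{v, a} \<in> E" "a \<in> leg v u"
      and bridge: "\<And>z t. z \<in> V \<Longrightarrow> z \<notin> leg v u \<Longrightarrow> t \<in> leg v u \<Longrightarrow> d z t = d z v + 1 + d a t"
      using leg_neighbour[OF v u(1)] by metis
    obtain a' where a': "{v, a'} \<in> E" "a' \<in> leg v u'"
      and bridge': "\<And>z t. z \<in> V \<Longrightarrow> z \<notin> leg v u' \<Longrightarrow> t \<in> leg v u' \<Longrightarrow> d z t = d z v + 1 + d a' t"
      using leg_neighbour[OF v u'(1)] by metis
    have "a \<noteq> a'" using legs_disjoint[OF v u(1) v u'(1) \<open>u \<noteq> u'\<close>] a a' by blast
    then obtain s where s: "s \<in> S" "d s a \<noteq> d s a'"
      using S edge_in_V(2)[OF a(1)] edge_in_V(2)[OF a'(1)]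
      unfolding resolving_set_def resolves_def by blast
    have "s \<in> V" using S s by (auto simp: resolving_set_def)
    then have "d s a = d s v + 1" "d s a' = d s v + 1"
      using bridge[of s a] bridge'[of s a'] u u' s a a' edge_in_V by auto
    then show False using s by simp
  qed
  then have "card (Ter v - {u \<in> Ter v. S \<inter> leg v u \<noteq> {}}) \<le> 1"
    by (intro card_le_Suc0_iff_eq[THEN iffD2, simplified One_nat_def[symmetric]]) auto
  moreover have "card (Ter v - {u \<in> Ter v. S \<inter> leg v u \<noteq> {}})
      = card (Ter v) - card {u \<in> Ter v. S \<inter> leg v u \<noteq> {}}"
    by (rule card_Diff_subset) auto
  ultimately show ?thesis by simp
qed

lemma resolving_set_card_ge:
  assumes S: "resolving_set V E S"
  shows "sigma V E \<le> card S + ex V E"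
proof -
  have finS: "finite S" using S finite_V by (auto simp: resolving_set_def intro: finite_subset)
  define H where "H v = {u \<in> Ter v. S \<inter> leg v u \<noteq> {}}" for v
  have Maj: "v \<in> Maj" if "v \<in> Ext" for v using that Ext_subset by blast
  have "(\<Sum>v\<in>Ext. card (Ter v) - 1) \<le> (\<Sum>v\<in>Ext. card (H v))"
    unfolding H_def by (intro sum_mono resolving_set_hits_legs[OF S] Maj)
  also have "\<dots> \<le> (\<Sum>v\<in>Ext. card (S \<inter> (\<Union>u\<in>H v. leg v u)))"
  proof (rule sum_mono)
    fix v assume v: "v \<in> Ext"
    have "card (H v) = (\<Sum>u\<in>H v. 1)" by simp
    also have "\<dots> \<le> (\<Sum>u\<in>H v. card (S \<inter> leg v u))"
      using finS by (intro sum_mono) (auto simp: H_def Suc_le_eq card_gt_0_iff)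
    also have "\<dots> = card (\<Union>u\<in>H v. S \<inter> leg v u)"
    proof (rule card_UN_disjoint[symmetric])
      show "\<forall>u\<in>H v. \<forall>u'\<in>H v. u \<noteq> u' \<longrightarrow> S \<inter> leg v u \<inter> (S \<inter> leg v u') = {}"
        using legs_disjoint[OF Maj[OF v] _ Maj[OF v]] unfolding H_def by blast
    qed (use finS in \<open>auto simp: H_def\<close>)
    finally show "card (H v) \<le> card (S \<inter> (\<Union>u\<in>H v. leg v u))"
      by (simp only: Int_UN_distrib)
  qed
  also have "\<dots> = card (\<Union>v\<in>Ext. S \<inter> (\<Union>u\<in>H v. leg v u))"
  proof (rule card_UN_disjoint[symmetric])
    show "\<forall>v\<in>Ext. \<forall>w\<in>Ext. v \<noteq> w \<longrightarrow>
      (S \<inter> (\<Union>u\<in>H v. leg v u)) \<inter> (S \<inter> (\<Union>u\<in>H w. leg w u)) = {}"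
    proof (intro ballI impI)
      fix v w assume vw: "v \<in> Ext" "w \<in> Ext" "v \<noteq> w"
      have "leg v u \<inter> leg w u' = {}" if "u \<in> H v" "u' \<in> H w" for u u'
        using that legs_disjoint[OF Maj[OF vw(1)] _ Maj[OF vw(2)]]
          Ter_disjoint[OF Maj[OF vw(1)] Maj[OF vw(2)] vw(3)]
        unfolding H_def by blast
      then show "(S \<inter> (\<Union>u\<in>H v. leg v u)) \<inter> (S \<inter> (\<Union>u\<in>H w. leg w u)) = {}"
        by blast
    qed
  qed (use finS in auto)
  also have "\<dots> \<le> card S" by (rule card_mono) (use finS in auto)
  finally show ?thesis by (simp add: sigma_eq)
qed

definition selected :: "'a set" where
  "selected = (\<Union>v\<in>Ext. Ter v - {SOME u. u \<in> Ter v})"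

lemma selected_subset: "selected \<subseteq> V"
  using Ter_subset by (auto simp: selected_def)

lemma card_selected: "card selected + ex V E \<le> sigma V E"
proof -
  have "card selected \<le> (\<Sum>v\<in>Ext. card (Ter v - {SOME u. u \<in> Ter v}))"
    unfolding selected_def by (rule card_UN_le) simp
  also have "\<dots> = (\<Sum>v\<in>Ext. card (Ter v) - 1)"
    by (rule sum.cong) (auto simp: card_Diff_singleton Ter_nonempty some_in_eq)
  finally show ?thesis by (simp add: sigma_eq)
qed

lemma selected_degree: "u \<in> selected \<Longrightarrow> degree E u = 1"
  using Ter_degree by (auto simp: selected_def)

lemma selected_misses_one:
  assumes "v \<in> Maj" "u \<in> Ter v" "u' \<in> Ter v" "u \<noteq> u'"
  shows "u \<in> selected \<or> u' \<in> selected"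
proof -
  have "v \<in> Ext"
    using assms by (auto simp: exterior_major_vertices_def ter_def card_gt_0_iff)
  then show ?thesis using assms by (auto simp: selected_def)
qed


lemma resolving_set_V: "resolving_set V E V"
  unfolding resolving_set_def resolves_def using gdist_eq_0 gdist_refl by (metis subset_refl)

lemma metric_dim_le: "resolving_set V E S \<Longrightarrow> metric_dim V E \<le> card S"
  unfolding metric_dim_def by (rule Least_le) blast

lemma metric_dim_attained:
  obtains S where "resolving_set V E S" "card S = metric_dim V E"
proof -
  have "\<exists>S. resolving_set V E S \<and> card S = metric_dim V E"
    unfolding metric_dim_def by (rule LeastI_ex) (use resolving_set_V in blast)
  then show thesis using that by blast
qed

section \<open>Paths\<close>

lemma resolving_singleton_imp_path:
  assumes "resolving_set V E {r}"
  shows "path_graph (card V - 1) V E"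
proof -
  have rV: "r \<in> V" using assms by (auto simp: resolving_set_def)
  have inj: "inj_on (d r) V"
    using assms by (auto simp: resolving_set_def resolves_def inj_on_def)
  define M where "M = Max (d r ` V)"
  have "M \<in> d r ` V" unfolding M_def using V_nonempty by (intro Max_in) auto
  then obtain z where z: "z \<in> V" "M = d r z" by blast
  have img: "d r ` V = {..M}"
  proof
    show "d r ` V \<subseteq> {..M}" by (auto simp: M_def)
    show "{..M} \<subseteq> d r ` V"
      using gdist_level_exists[OF rV z(1)] z(2) by fastforce
  qed
  then have "card V = Suc M" using card_image[OF inj] by simp
  define g where "g = the_inv_into V (d r)"
  have gd: "g (d r x) = x" if "x \<in> V" for x
    unfolding g_def using that inj by (simp add: the_inv_into_f_f)
  have dg: "d r (g i) = i" "g i \<in> V" if "i \<le> M" for i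
    using f_the_inv_into_f[OF inj, of i] the_inv_into_into[OF inj, of i V] that
    by (auto simp: g_def img)
  define xs where "xs = map g [0..<Suc M]"
  have nth: "xs ! i = g i" if "i \<le> M" for i
    using that unfolding xs_def by (simp del: upt_Suc)
  have "distinct xs"
    unfolding xs_def distinct_map
    by (intro conjI distinct_upt inj_on_inverseI[of _ "d r"] dg(1)) auto
  moreover have "length xs = Suc M" by (simp add: xs_def)
  moreover have "set xs = V"
  proof
    show "set xs \<subseteq> V" using dg(2) by (auto simp: xs_def simp del: upt_Suc)
    show "V \<subseteq> set xs"
    proof
      fix x assume x: "x \<in> V"
      then have "d r x \<le> M" using img by auto
      then show "x \<in> set xs"
        using gd[OF x] nth[of "d r x"] nth_mem[of "d r x" xs] by (simp add: xs_def del: upt_Suc)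
    qed
  qed
  moreover have "E = {{xs ! i, xs ! Suc i} | i. i < M}"
  proof
    have edge: "\<exists>i<M. {x, y} = {g i, g (Suc i)}" if "{x, y} \<in> E" "d r y = d r x + 1" for x y
    proof -
      have "x \<in> V" "y \<in> V" using edge_in_V that by auto
      then have "x = g (d r x)" "y = g (Suc (d r x))" "d r y \<in> {..M}"
        using gd[of x] gd[of y] that(2) img by (simp, simp, blast)
      moreover from this(3) have "d r x < M" using that(2) by simp
      ultimately show ?thesis by metis
    qed
    show "E \<subseteq> {{xs ! i, xs ! Suc i} | i. i < M}"
    proof
      fix e assume e: "e \<in> E"
      then obtain x y where xy: "e = {x, y}" using edge_card by (metis card_2_iff)
      then have "x \<in> V" "y \<in> V" "x \<noteq> y" using e edge_in_V edge_neq by auto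
      then have "d r x \<noteq> d r y" using inj by (auto simp: inj_on_def)
      then consider "d r y = d r x + 1" | "d r x = d r y + 1"
        using gdist_edge_le[of x y r] gdist_edge_le[of y x r] e xy edge_sym[of x y] rV by fastforce
      then obtain i where i: "i < M" "e = {g i, g (Suc i)}"
        using edge[of x y] edge[of y x] e xy edge_sym[of x y] by cases (auto simp: insert_commute)
      then have "e = {xs ! i, xs ! Suc i}" using nth[of i] nth[of "Suc i"] by simp
      then show "e \<in> {{xs ! i, xs ! Suc i} | i. i < M}" using i(1) by blast
    qed
    show "{{xs ! i, xs ! Suc i} | i. i < M} \<subseteq> E"
    proof
      fix e assume "e \<in> {{xs ! i, xs ! Suc i} | i. i < M}"
      then obtain i where i: "i < M" "e = {g i, g (Suc i)}" using nth by auto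
      have "r \<noteq> g (Suc i)" using dg(1)[of "Suc i"] i rV by auto
      then obtain w where w: "{w, g (Suc i)} \<in> E" "d r (g (Suc i)) = d r w + 1"
        using gdist_step_back[OF rV dg(2)[of "Suc i"]] i(1) by (metis Suc_leI)
      then have "w = g i" using dg(1)[of "Suc i"] i(1) gd[OF edge_in_V(1)[OF w(1)]] by simp
      then show "e \<in> E" using w i by simp
    qed
  qed
  ultimately show ?thesis
    using \<open>card V = Suc M\<close> unfolding path_graph_def by auto
qed

lemma path_graph_resolving:
  assumes "path_graph n V E"
  obtains r where "resolving_set V E {r}"
proof -
  obtain xs where xs: "distinct xs" "length xs = Suc n" "set xs = V"
    "E = {{xs ! i, xs ! Suc i} | i. i < n}"
    using assms unfolding path_graph_def by blast
  define f where "f x = (SOME i. i < length xs \<and> xs ! i = x)" for x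
  have f: "f (xs ! i) = i" if "i \<le> n" for i
  proof -
    have "f (xs ! i) < length xs \<and> xs ! f (xs ! i) = xs ! i"
      unfolding f_def by (rule someI[of _ i]) (use that xs in auto)
    then show ?thesis using nth_eq_iff_index_eq[OF xs(1)] that xs(2) by auto
  qed
  have inV: "xs ! i \<in> V" if "i \<le> n" for i
    using that xs(2) by (auto simp: xs(3)[symmetric])
  have lip: "f x \<le> f y + 1" if xy: "{x, y} \<in> E" for x y
  proof -
    obtain i where "{x, y} = {xs ! i, xs ! Suc i}" "i < n"
      using xy xs(4) by auto
    then show ?thesis using f[of i] f[of "Suc i"] by (auto simp: doubleton_eq_iff)
  qed
  have le: "d (xs ! 0) (xs ! i) \<le> i" if "i \<le> n" for i
    using that
  proof (induction i)
    case (Suc i)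
    then have "{xs ! i, xs ! Suc i} \<in> E" using xs(4) by auto
    from gdist_edge_le[OF this inV[of 0]] Suc show ?case by simp
  qed (use inV in simp)
  have dist: "d (xs ! 0) (xs ! i) = i" if "i \<le> n" for i
    using gdist_lipschitz[of f, OF lip inV[OF that] inV[of 0]] f[OF that] f[of 0] le[OF that]
      gdist_sym[OF inV[OF that] inV[of 0]] by simp
  have "resolving_set V E {xs ! 0}"
    unfolding resolving_set_def resolves_def
  proof (intro conjI ballI impI)
    fix u v assume uv: "u \<in> V" "v \<in> V" "u \<noteq> v"
    then obtain i j where "i \<le> n" "j \<le> n" "u = xs ! i" "v = xs ! j"
      using xs(2,3) by (metis in_set_conv_nth less_Suc_eq_le)
    then show "\<exists>w\<in>{xs ! 0}. d w u \<noteq> d w v" using dist uv(3) by auto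
  qed (use inV in simp)
  then show thesis using that by blast
qed

lemma L_le_metric_dim: "L V E \<le> int (metric_dim V E)"
proof (cases "\<exists>n\<ge>1. path_graph n V E")
  case True
  then obtain n xs where n: "n \<ge> 1" and xs: "distinct xs" "length xs = Suc n" "set xs = V"
    unfolding path_graph_def by blast
  have uv: "xs ! 0 \<in> V" "xs ! 1 \<in> V" "xs ! 0 \<noteq> xs ! 1"
    using n xs nth_mem[of _ xs] by (auto simp: nth_eq_iff_index_eq)
  obtain S where S: "resolving_set V E S" "card S = metric_dim V E"
    by (rule metric_dim_attained)
  have "S \<noteq> {}" using S(1) uv unfolding resolving_set_def by blast
  moreover have "finite S" using S(1) finite_V by (auto simp: resolving_set_def intro: finite_subset)
  ultimately have "metric_dim V E > 0" using S(2) by (metis card_gt_0_iff)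
  then show ?thesis using True by (simp add: L_def)
next
  case False
  obtain S where "resolving_set V E S" "card S = metric_dim V E"
    by (rule metric_dim_attained)
  then show ?thesis using resolving_set_card_ge[of S] False unfolding L_def by auto
qed

end

section \<open>Breadth-first trees\<close>

locale rooted_graph = conn_graph +
  fixes r :: 'a
  assumes root: "r \<in> V"
begin

definition par :: "'a \<Rightarrow> 'a" where
  "par v = (if v = r then r else SOME w. {w, v} \<in> E \<and> d r v = d r w + 1)"

lemma par_root [simp]: "par r = r"
  by (simp add: par_def)

lemma par_step:
  assumes "v \<in> V" "v \<noteq> r"
  shows "{par v, v} \<in> E" "d r v = d r (par v) + 1"
proof -
  have "\<exists>w. {w, v} \<in> E \<and> d r v = d r w + 1"
    using gdist_step_back[OF root assms(1)] assms(2) by metis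
  then have "{par v, v} \<in> E \<and> d r v = d r (par v) + 1"
    unfolding par_def using assms(2) by (simp only: if_False) (rule someI_ex)
  then show "{par v, v} \<in> E" "d r v = d r (par v) + 1" by auto
qed

lemma par_in_V: "v \<in> V \<Longrightarrow> par v \<in> V"
  using par_step(1)[of v] edge_in_V(1) root by (cases "v = r") auto

lemma depth_par: "v \<in> V \<Longrightarrow> d r (par v) = d r v - 1"
  using par_step(2)[of v] root by (cases "v = r") auto

lemma depth_0: "v \<in> V \<Longrightarrow> d r v = 0 \<longleftrightarrow> v = r"
  using gdist_eq_0[OF root, of v] by auto

lemma funpow_par_in_V: "v \<in> V \<Longrightarrow> (par ^^ k) v \<in> V"
  by (induction k) (auto simp: par_in_V)

lemma depth_funpow_par: "v \<in> V \<Longrightarrow> d r ((par ^^ k) v) = d r v - k"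
  by (induction k) (auto simp: depth_par funpow_par_in_V)

definition desc :: "'a \<Rightarrow> 'a set" where
  "desc w = {t \<in> V. \<exists>k. (par ^^ k) t = w}"

lemma desc_in_V: "t \<in> desc w \<Longrightarrow> t \<in> V" "t \<in> desc w \<Longrightarrow> w \<in> V"
  using funpow_par_in_V by (auto simp: desc_def)

lemma funpow_par_desc: "t \<in> V \<Longrightarrow> t \<in> desc ((par ^^ k) t)"
  by (auto simp: desc_def)

lemma desc_refl: "t \<in> V \<Longrightarrow> t \<in> desc t"
  using funpow_par_desc[of t 0] by simp

lemma desc_par: "t \<in> V \<Longrightarrow> t \<in> desc (par t)"
  using funpow_par_desc[of t 1] by simp

lemma desc_trans:
  assumes "t \<in> desc w" "w \<in> desc v"
  shows "t \<in> desc v"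
proof -
  obtain k l where "(par ^^ k) t = w" "(par ^^ l) w = v"
    using assms by (auto simp: desc_def)
  then have "(par ^^ (l + k)) t = v" by (simp add: funpow_add)
  then show ?thesis using assms(1) unfolding desc_def by blast
qed

lemma par_in_desc:
  assumes "t \<in> desc w" "t \<noteq> w"
  shows "par t \<in> desc w"
proof -
  obtain k where k: "(par ^^ k) t = w" using assms(1) by (auto simp: desc_def)
  then obtain j where "k = Suc j" using assms(2) by (cases k) auto
  then have "(par ^^ j) (par t) = w" using k by (simp add: funpow_swap1)
  then show ?thesis using par_in_V[OF desc_in_V(1)[OF assms(1)]] by (auto simp: desc_def)
qed

lemma desc_funpow:
  assumes "t \<in> desc w"
  shows "(par ^^ (d r t - d r w)) t = w"
proof -
  have tV: "t \<in> V" and wV: "w \<in> V" using desc_in_V assms by auto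
  obtain k where k: "(par ^^ k) t = w" using assms by (auto simp: desc_def)
  then have dw: "d r w = d r t - k" using depth_funpow_par[OF tV] by metis
  show ?thesis
  proof (cases "k \<le> d r t")
    case True
    then show ?thesis using k dw by simp
  next
    case False
    then have "w = r" using dw depth_0[OF wV] by simp
    moreover have "(par ^^ d r t) t = r"
      using depth_0[OF funpow_par_in_V[OF tV], of "d r t"] depth_funpow_par[OF tV, of "d r t"] by simp
    ultimately show ?thesis using root by simp
  qed
qed

lemma desc_depth_le: "t \<in> desc w \<Longrightarrow> d r w \<le> d r t"
  using depth_funpow_par by (auto simp: desc_def)

lemma desc_unique: "t \<in> desc b \<Longrightarrow> t \<in> desc b' \<Longrightarrow> d r b = d r b' \<Longrightarrow> b = b'"
  using desc_funpow by metis

lemma desc_dist: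
  assumes "t \<in> desc w"
  shows "d r t = d r w + d w t"
proof -
  have tV: "t \<in> V" and wV: "w \<in> V" using desc_in_V assms by auto
  have "d ((par ^^ k) t) t \<le> k" for k
  proof (induction k)
    case (Suc k)
    let ?x = "(par ^^ k) t"
    have xV: "?x \<in> V" using funpow_par_in_V[OF tV] .
    have "d (par ?x) ?x \<le> 1"
      using gdist_edge[OF par_step(1)[OF xV]] root by (cases "?x = r") auto
    then have "d (par ?x) t \<le> 1 + d ?x t"
      using gdist_triangle[OF par_in_V[OF xV] xV tV] by simp
    then show ?case using Suc by simp
  qed (use tV in simp)
  from this[of "d r t - d r w"] have "d w t \<le> d r t - d r w"
    using desc_funpow[OF assms] by simp
  moreover have "d r t \<le> d r w + d w t" by (rule gdist_triangle[OF root wV tV])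
  ultimately show ?thesis using desc_depth_le[OF assms] by simp
qed

definition tree_edges :: "'a set set" where
  "tree_edges = (\<lambda>v. {par v, v}) ` (V - {r})"

definition cotree :: "'a set set" where
  "cotree = E - tree_edges"

definition ends :: "'a set" where
  "ends = \<Union>cotree"

lemma card_tree_edges: "card tree_edges = card V - 1"
proof -
  have "inj_on (\<lambda>v. {par v, v}) (V - {r})"
  proof (rule inj_onI, rule ccontr)
    fix v w assume *: "v \<in> V - {r}" "w \<in> V - {r}" "{par v, v} = {par w, w}" "v \<noteq> w"
    then have "par v = w" "par w = v" by (auto simp: doubleton_eq_iff)
    then show False using par_step(2)[of v] par_step(2)[of w] * by simp
  qed
  then show ?thesis using root by (simp add: tree_edges_def card_image card_Diff_singleton)
qed

lemma cycle_rank_eq: "cycle_rank V E = int (card cotree)"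
proof -
  have "tree_edges \<subseteq> E" using par_step(1) by (auto simp: tree_edges_def)
  then have "card E = card cotree + card tree_edges"
    unfolding cotree_def by (metis card_Diff_subset card_mono finite_E finite_subset le_add_diff_inverse2)
  moreover have "card V \<ge> 1" using root by (simp add: Suc_le_eq card_gt_0_iff) auto
  ultimately show ?thesis by (simp add: cycle_rank_def card_tree_edges)
qed

lemma finite_cotree [simp]: "finite cotree"
  by (simp add: cotree_def)

lemma ends_subset: "ends \<subseteq> V"
  using edge_subset by (auto simp: ends_def cotree_def)

lemma card_ends: "card ends \<le> 2 * card cotree"
proof -
  have "card ends \<le> (\<Sum>e\<in>cotree. card e)"
    unfolding ends_def using card_UN_le[OF finite_cotree, of "\<lambda>e. e"] by simp
  also have "\<dots> = (\<Sum>e\<in>cotree. 2)"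
    by (rule sum.cong) (auto simp: cotree_def edge_card)
  finally show ?thesis by simp
qed

lemma edge_cases:
  assumes "{x, y} \<in> E" "x \<notin> ends"
  obtains "x \<noteq> r" "y = par x" | "y \<noteq> r" "x = par y"
proof -
  have "{x, y} \<in> tree_edges" using assms by (auto simp: ends_def cotree_def)
  then obtain v where "v \<in> V - {r}" "{x, y} = {par v, v}" by (auto simp: tree_edges_def)
  then show thesis using that by (auto simp: doubleton_eq_iff)
qed

lemma childless_degree:
  assumes "u \<in> V" "u \<noteq> r" "u \<notin> ends" and childless: "\<And>y. y \<in> V \<Longrightarrow> y \<noteq> r \<Longrightarrow> par y \<noteq> u"
  shows "degree E u = 1"
proof -
  have "{e \<in> E. u \<in> e} = {{par u, u}}"
  proof (intro equalityI subsetI)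
    fix e assume "e \<in> {e \<in> E. u \<in> e}"
    then obtain y where y: "e = {u, y}" "{u, y} \<in> E" using edge_elim by blast
    from y(2) assms(3) show "e \<in> {{par u, u}}"
      by (cases rule: edge_cases) (use y childless[of y] edge_in_V(2)[OF y(2)] in \<open>auto simp: insert_commute\<close>)
  qed (use par_step(1)[OF assms(1,2)] in auto)
  then show ?thesis by (simp add: degree_def)
qed

section \<open>The skeleton spanned by the cotree edges\<close>

definition skel :: "'a set" where
  "skel = {v \<in> V. v = r \<or> (\<exists>y\<in>ends. y \<in> desc v)}"

lemma skel_subset: "skel \<subseteq> V" by (auto simp: skel_def)

lemma finite_skel [simp]: "finite skel"
  using skel_subset finite_V by (rule finite_subset)

lemma root_in_skel: "r \<in> skel" using root by (simp add: skel_def)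

lemma ends_in_skel: "ends \<subseteq> skel"
  using ends_subset desc_refl by (auto simp: skel_def)

lemma skel_up:
  assumes "t \<in> skel" "t \<in> desc w"
  shows "w \<in> skel"
proof (cases "t = r")
  case True
  then have "d r w = 0" using desc_depth_le[OF assms(2)] root by simp
  then show ?thesis using depth_0 desc_in_V[OF assms(2)] root_in_skel by simp
next
  case False
  then show ?thesis using assms desc_trans desc_in_V unfolding skel_def by blast
qed

lemma gdist_hanging:
  assumes w: "w \<in> V" "w \<notin> skel" and z: "z \<in> V" "z \<notin> desc w" and t: "t \<in> desc w"
  shows "d z t = d z (par w) + 1 + d w t"
proof (rule gdist_bridge[where D = "desc w"])
  have "w \<noteq> r" using w root_in_skel by auto
  then show "{par w, w} \<in> E" by (rule par_step(1)[OF w(1)])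
  show "w \<in> desc w" by (rule desc_refl[OF w(1)])
  show "par w \<notin> desc w"
    using desc_depth_le[of "par w" w] par_step(2)[OF w(1) \<open>w \<noteq> r\<close>] by auto
  show "x = w \<and> y = par w" if xy: "{x, y} \<in> E" "x \<in> desc w" "y \<notin> desc w" for x y
  proof -
    have "x \<notin> ends" using skel_up[OF _ xy(2)] w(2) ends_in_skel by blast
    with xy(1) show ?thesis
    proof (cases rule: edge_cases)
      case 1
      then show ?thesis using par_in_desc[OF xy(2)] xy(3) by auto
    next
      case 2
      then show ?thesis
        using edge_in_V(2)[OF xy(1)] xy(2,3) by (metis desc_par desc_trans)
    qed
  qed
qed (use z t desc_in_V(1)[OF t] in auto)

lemma gdist_hanging_root:
  assumes "w \<in> V" "w \<notin> skel" "x \<in> skel"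
  shows "d x w = d x (par w) + 1"
  using gdist_hanging[OF assms(1,2) _ _ desc_refl[OF assms(1)], of x] assms skel_up skel_subset by auto

lemma attachment:
  assumes "t \<in> V"
  obtains i where "(par ^^ i) t \<in> skel" "\<And>j. j < i \<Longrightarrow> (par ^^ j) t \<notin> skel"
    "\<And>x. x \<in> skel \<Longrightarrow> d x t = d x ((par ^^ i) t) + i"
proof -
  define i where "i = (LEAST i. (par ^^ i) t \<in> skel)"
  have "d r ((par ^^ d r t) t) = 0" using depth_funpow_par[OF assms] by simp
  then have "(par ^^ d r t) t \<in> skel"
    using depth_0[OF funpow_par_in_V[OF assms]] root_in_skel by simp
  then have 1: "(par ^^ i) t \<in> skel" unfolding i_def by (rule LeastI)
  have 2: "(par ^^ j) t \<notin> skel" if "j < i" for j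
    using not_less_Least[of j "\<lambda>i. (par ^^ i) t \<in> skel"] that by (simp add: i_def)
  have "d x t = d x ((par ^^ j) t) + j" if "x \<in> skel" "j \<le> i" for x j
    using that(2)
  proof (induction j)
    case (Suc j)
    then show ?case
      using gdist_hanging_root[OF funpow_par_in_V[OF assms] 2 that(1), of j] by simp
  qed simp
  then show thesis using that[of i] 1 2 by blast
qed

definition children :: "'a \<Rightarrow> 'a set" where
  "children v = {w \<in> skel. w \<noteq> r \<and> par w = v}"

definition forks :: "'a set" where
  "forks = {v \<in> skel. card (children v) \<ge> 2}"

definition landmarks :: "'a set" where
  "landmarks = insert r (ends \<union> forks)"

lemma landmarks_subset: "landmarks \<subseteq> skel"
  using root_in_skel ends_in_skel by (auto simp: landmarks_def forks_def)

lemma children_nonempty: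
  assumes "u \<in> skel" "u \<noteq> r" "u \<notin> ends"
  shows "children u \<noteq> {}"
proof -
  obtain y where y: "y \<in> ends" "y \<in> desc u" using assms by (auto simp: skel_def)
  then obtain k where k: "(par ^^ k) y = u" by (auto simp: desc_def)
  then obtain j where j: "k = Suc j" using assms(3) y by (cases k) auto
  let ?w = "(par ^^ j) y"
  have yV: "y \<in> V" using y ends_subset by auto
  have "par ?w = u" using k j by simp
  moreover from this have "?w \<noteq> r" using assms(2) by auto
  moreover have "?w \<in> skel"
    using skel_up[OF _ funpow_par_desc[OF yV]] y ends_in_skel by blast
  ultimately show ?thesis by (auto simp: children_def)
qed

lemma card_forks: "card forks \<le> card ends"
proof -
  have fin: "finite ends" using ends_in_skel finite_skel by (rule finite_subset)
  have "(\<Sum>v\<in>skel. card (children v)) = card (skel - {r})"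
  proof -
    have "par ` (skel - {r}) \<subseteq> skel"
      using skel_up desc_par skel_subset by blast
    then have "(\<Sum>v\<in>skel. \<Sum>w\<in>{w \<in> skel - {r}. par w = v}. 1) = (\<Sum>w\<in>skel - {r}. (1::nat))"
      by (intro sum.group) auto
    moreover have "{w \<in> skel - {r}. par w = v} = children v" for v
      by (auto simp: children_def)
    ultimately show ?thesis by simp
  qed
  moreover have "(\<Sum>v\<in>skel. 1 + (if v \<in> forks then 1 else 0)) \<le>
      (\<Sum>v\<in>skel. card (children v) + (if v \<in> insert r ends then 1 else 0))"
  proof (rule sum_mono)
    fix v assume v: "v \<in> skel"
    have "finite (children v)" by (simp add: children_def)
    then have "v \<notin> insert r ends \<Longrightarrow> card (children v) \<ge> 1"
      using children_nonempty[OF v] by (simp add: Suc_le_eq card_gt_0_iff)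
    moreover have "v \<in> forks \<Longrightarrow> card (children v) \<ge> 2" by (simp add: forks_def)
    ultimately show "1 + (if v \<in> forks then 1 else 0) \<le>
        card (children v) + (if v \<in> insert r ends then 1 else 0)"
      by (cases "v \<in> forks"; cases "v \<in> insert r ends") auto
  qed
  moreover have "(\<Sum>v\<in>skel. 1 + (if v \<in> forks then 1 else 0)) = card skel + card forks"
  proof -
    have "skel \<inter> forks = forks" by (auto simp: forks_def)
    then show ?thesis by (simp only: sum.distrib sum.If_cases[OF finite_skel] Collect_mem_eq) simp
  qed
  moreover have "(\<Sum>v\<in>skel. card (children v) + (if v \<in> insert r ends then 1 else 0))
      = (\<Sum>v\<in>skel. card (children v)) + card (insert r ends)"
  proof -
    have "skel \<inter> insert r ends = insert r ends" using ends_in_skel root_in_skel by auto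
    then show ?thesis by (simp only: sum.distrib sum.If_cases[OF finite_skel] Collect_mem_eq) simp
  qed
  moreover have "card (insert r ends) \<le> 1 + card ends" using fin by (simp add: card_insert_if)
  moreover have "card (skel - {r}) + 1 = card skel"
    using root_in_skel by (metis Suc_eq_plus1 card_Suc_Diff1 finite_skel)
  ultimately show ?thesis by linarith
qed

lemma card_landmarks: "card landmarks \<le> 1 + 4 * card cotree"
proof -
  have "finite (ends \<union> forks)"
    using landmarks_subset finite_skel by (auto simp: landmarks_def intro: finite_subset)
  then have "card landmarks \<le> 1 + card (ends \<union> forks)"
    by (simp add: landmarks_def card_insert_if)
  also have "card (ends \<union> forks) \<le> card ends + card forks" by (rule card_Un_le)
  finally show ?thesis using card_forks card_ends by simp
qed

text \<open>An edge at a skeleton vertex that is not a landmark leads to the parent, to the unique child in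
  the skeleton, or into a hanging tree, which is a dead end.\<close>

lemma landmark_below:
  assumes "u \<in> skel"
  shows "\<exists>b\<in>landmarks. b \<in> desc u \<and>
    (\<forall>x\<in>landmarks. d u x = d u b + d b x \<or> u \<noteq> r \<and> d u x = d (par u) x + 1)"
  using assms
proof (induction "Max (d r ` V) - d r u" arbitrary: u rule: less_induct)
  case less
  have uV: "u \<in> V" using less.prems skel_subset by blast
  show ?case
  proof (cases "u \<in> landmarks")
    case True
    then show ?thesis using desc_refl[OF uV] uV by (intro bexI[of _ u]) auto
  next
    case False
    then have u: "u \<noteq> r" "u \<notin> ends" "u \<notin> forks" by (auto simp: landmarks_def)
    obtain w where w: "w \<in> skel" "w \<noteq> r" "par w = u"
      using children_nonempty[OF less.prems u(1,2)] by (auto simp: children_def)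
    have wV: "w \<in> V" using w skel_subset by blast
    have unique: "w' = w" if "w' \<in> skel" "w' \<noteq> r" "par w' = u" for w'
    proof -
      have "card (children u) \<le> Suc 0" using u(3) less.prems by (simp add: forks_def)
      moreover have "finite (children u)" by (simp add: children_def)
      ultimately have "\<forall>x\<in>children u. \<forall>y\<in>children u. x = y"
        by (simp add: card_le_Suc0_iff_eq)
      moreover have "w' \<in> children u" "w \<in> children u" using that w by (auto simp: children_def)
      ultimately show ?thesis by blast
    qed
    have dw: "d r w = d r u + 1" using par_step(2)[OF wV w(2)] w(3) by simp
    moreover have "d r w \<le> Max (d r ` V)" using wV by simp
    ultimately have "Max (d r ` V) - d r w < Max (d r ` V) - d r u" by simp
    from less.hyps[OF this w(1)] obtain b where b: "b \<in> landmarks" "b \<in> desc w"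
      and far: "\<And>x. x \<in> landmarks \<Longrightarrow> d w x = d w b + d b x \<or> d w x = d u x + 1"
      using w(3) by blast
    have bu: "b \<in> desc u" using desc_trans[OF b(2)] desc_par[OF wV] w(3) by simp
    have dub: "d u b = 1 + d w b"
      using desc_dist[OF b(2)] desc_dist[OF bu] dw by simp
    have "d u x = d u b + d b x \<or> u \<noteq> r \<and> d u x = d (par u) x + 1" if x: "x \<in> landmarks" for x
    proof -
      have xs: "x \<in> skel" using x landmarks_subset by blast
      then have xV: "x \<in> V" using skel_subset by blast
      have "u \<noteq> x" using x False by auto
      then obtain y where y: "{u, y} \<in> E" "d u x = d y x + 1"
        using gdist_step[OF uV xV] by metis
      have yV: "y \<in> V" using edge_in_V y by auto
      from y(1) u(2) show ?thesis
      proof (cases rule: edge_cases)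
        case 1
        then show ?thesis using y(2) by simp
      next
        case 2
        have "y \<in> skel"
        proof (rule ccontr)
          assume "y \<notin> skel"
          then have "d x y = d x u + 1" using gdist_hanging_root[OF yV _ xs] 2 by simp
          then show False using y(2) gdist_sym[OF xV yV] gdist_sym[OF xV uV] by simp
        qed
        then have "y = w" using unique 2 by simp
        then show ?thesis using far[OF x] y(2) dub by auto
      qed
    qed
    then show ?thesis using b(1) bu by blast
  qed
qed

lemma landmarks_doubly_resolve_le:
  assumes u: "u \<in> skel" and v: "v \<in> skel"
    and eq: "\<And>x. x \<in> landmarks \<Longrightarrow> d x u = d x v + h"
  shows "u = v"
proof -
  have uV: "u \<in> V" and vV: "v \<in> V" using u v skel_subset by auto
  have rl: "r \<in> landmarks" by (simp add: landmarks_def)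
  obtain b where b: "b \<in> landmarks" "b \<in> desc u"
    "\<And>x. x \<in> landmarks \<Longrightarrow> d u x = d u b + d b x \<or> u \<noteq> r \<and> d u x = d (par u) x + 1"
    using landmark_below[OF u] by blast
  obtain b' where b': "b' \<in> landmarks" "b' \<in> desc v"
    "\<And>x. x \<in> landmarks \<Longrightarrow> d v x = d v b' + d b' x \<or> v \<noteq> r \<and> d v x = d (par v) x + 1"
    using landmark_below[OF v] by blast
  have bV: "b \<in> V" and b'V: "b' \<in> V" using b b' desc_in_V by auto
  note sym = gdist_sym[OF uV bV] gdist_sym[OF vV bV] gdist_sym[OF uV b'V] gdist_sym[OF vV b'V]
    gdist_sym[OF bV b'V]
  have h: "h = 0"
    using desc_dist[OF b(2)] gdist_triangle[OF root vV bV] eq[OF rl] eq[OF b(1)] sym by simp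
  have depth: "d r u = d r v" using eq[OF rl] h by simp
  have via_parent: False
    if "x \<in> V" "y \<in> V" "c \<in> desc y" "d r x = d r y" "d x c = d y c"
      "x \<noteq> r" "d x c = d (par x) c + 1" for x y c
    using gdist_triangle[OF root par_in_V[OF that(1)] desc_in_V(1)[OF that(3)]]
      par_step(2)[OF that(1,6)] desc_dist[OF that(3)] that by simp
  have "d u b' = d u b + d b b'"
    using b(3)[OF b'(1)] via_parent[OF uV vV b'(2) depth] eq[OF b'(1)] h sym by auto
  moreover have "d v b = d v b' + d b' b"
    using b'(3)[OF b(1)] via_parent[OF vV uV b(2) depth[symmetric]] eq[OF b(1)] h sym by auto
  ultimately have "d b b' = 0"
    using eq[OF b(1)] eq[OF b'(1)] h sym by simp
  then have "b = b'" using gdist_eq_0[OF bV b'V] by simp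
  then show ?thesis using desc_unique[OF b(2)] b'(2) depth by simp
qed

lemma landmarks_doubly_resolve:
  assumes "u \<in> skel" "v \<in> skel" "\<And>x. x \<in> landmarks \<Longrightarrow> d x u + i = d x v + j"
  shows "u = v"
proof (cases "i \<le> j")
  case True
  show ?thesis
    by (rule landmarks_doubly_resolve_le[OF assms(1,2), of "j - i"]) (use assms(3) True in fastforce)
next
  case False
  have "v = u"
    by (rule landmarks_doubly_resolve_le[OF assms(2,1), of "i - j"]) (use assms(3) False in fastforce)
  then show ?thesis by simp
qed

section \<open>Hanging trees\<close>

lemma finite_desc [simp]: "finite (desc b)"
  by (rule finite_subset[OF _ finite_V]) (auto simp: desc_def)

lemma hanging_terminal:
  assumes b: "b \<in> V" "b \<notin> skel" and major: "desc b \<inter> Maj = {}"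
  shows "desc b \<inter> Ter (par b) \<noteq> {}"
proof -
  have br: "b \<noteq> r" using b root_in_skel by auto
  obtain u where u: "u \<in> desc b" "\<And>x. x \<in> desc b \<Longrightarrow> d r x \<le> d r u"
    using finite_has_max[of "desc b" "d r"] desc_refl[OF b(1)] by auto
  have uV: "u \<in> V" using u desc_in_V by auto
  have "u \<notin> skel" using skel_up[OF _ u(1)] b by blast
  then have ur: "u \<noteq> r" and ue: "u \<notin> ends" using root_in_skel ends_in_skel by auto
  have "par y \<noteq> u" if y: "y \<in> V" "y \<noteq> r" for y
  proof
    assume "par y = u"
    then have "y \<in> desc b" using desc_trans[OF _ u(1)] desc_par y by metis
    then show False using u(2)[of y] par_step(2)[OF y] \<open>par y = u\<close> by simp
  qed
  then have "u \<in> terminal_vertices V E"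
    using childless_degree[OF uV ur ue] uV by (simp add: terminal_vertices_def)
  moreover have "d u (par b) < d u w" if w: "w \<in> Maj" "w \<noteq> par b" for w
  proof -
    have wV: "w \<in> V" using w Maj_subset by blast
    have pV: "par b \<in> V" using par_in_V b by blast
    have "w \<notin> desc b" using major w by blast
    then have "d w u = d w (par b) + 1 + d b u" by (rule gdist_hanging[OF b wV _ u(1)])
    moreover have "d w (par b) > 0" using gdist_eq_0[OF wV pV] w by simp
    moreover have "d r u = d r (par b) + d (par b) u"
      using desc_dist[OF desc_trans[OF u(1) desc_par[OF b(1)]]] .
    ultimately show ?thesis
      using desc_dist[OF u(1)] par_step(2)[OF b(1) br] gdist_sym[OF uV wV] gdist_sym[OF uV pV] by simp
  qed
  ultimately have "u \<in> Ter (par b)" by (simp add: terminal_vertices_of_def)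
  then show ?thesis using u by blast
qed

lemma hanging_no_major:
  assumes b: "b \<in> V" "b \<notin> skel" and free: "desc b \<inter> selected = {}"
  shows "desc b \<inter> Maj = {}"
proof (rule ccontr)
  assume "desc b \<inter> Maj \<noteq> {}"
  then obtain m where m: "m \<in> desc b" "m \<in> Maj" "\<And>x. x \<in> desc b \<inter> Maj \<Longrightarrow> d r x \<le> d r m"
    using finite_has_max[of "desc b \<inter> Maj" "d r"] by auto
  have mV: "m \<in> V" using m desc_in_V by auto
  have "m \<notin> skel" using skel_up[OF _ m(1)] b by blast
  then have "m \<notin> ends" using ends_in_skel by auto
  define C where "C = {y \<in> V. y \<noteq> r \<and> par y = m}"
  have finC: "finite C" by (simp add: C_def)
  have "{e \<in> E. m \<in> e} \<subseteq> insert {par m, m} ((\<lambda>y. {m, y}) ` C)"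
  proof
    fix e assume "e \<in> {e \<in> E. m \<in> e}"
    then obtain y where y: "e = {m, y}" "{m, y} \<in> E" using edge_elim by blast
    from y(2) \<open>m \<notin> ends\<close> show "e \<in> insert {par m, m} ((\<lambda>y. {m, y}) ` C)"
      by (cases rule: edge_cases) (use y edge_in_V in \<open>auto simp: C_def insert_commute\<close>)
  qed
  then have "degree E m \<le> card (insert {par m, m} ((\<lambda>y. {m, y}) ` C))"
    unfolding degree_def by (rule card_mono[rotated]) (simp add: finC)
  also have "\<dots> \<le> Suc (card ((\<lambda>y. {m, y}) ` C))" using finC by (simp add: card_insert_if)
  also have "\<dots> \<le> Suc (card C)" using card_image_le[OF finC] by simp
  finally have "\<not> card C \<le> Suc 0" using m(2) by (simp add: major_vertices_def)
  then obtain y z where yz: "y \<in> C" "z \<in> C" "y \<noteq> z"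
    using card_le_Suc0_iff_eq[OF finC] by blast
  have child: "\<exists>t. t \<in> desc c \<and> t \<in> Ter m" "desc c \<subseteq> desc b" "d r c = d r m + 1" if "c \<in> C" for c
  proof -
    have c: "c \<in> V" "c \<noteq> r" "par c = m" using that by (auto simp: C_def)
    have cb: "c \<in> desc b" using desc_trans[OF desc_par[OF c(1)]] c(3) m(1) by simp
    then show "desc c \<subseteq> desc b" using desc_trans by blast
    show dc: "d r c = d r m + 1" using par_step(2)[OF c(1,2)] c(3) by simp
    have "c \<notin> skel" using skel_up[OF _ cb] b by blast
    moreover have "desc c \<inter> Maj = {}"
      using m(3) \<open>desc c \<subseteq> desc b\<close> desc_depth_le[of _ c] dc by fastforce
    ultimately show "\<exists>t. t \<in> desc c \<and> t \<in> Ter m"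
      using hanging_terminal[OF c(1)] c(3) by blast
  qed
  obtain t t' where t: "t \<in> desc y" "t \<in> Ter m" "t' \<in> desc z" "t' \<in> Ter m"
    using child(1) yz by blast
  have "t \<noteq> t'" using desc_unique[of t y z] t yz child(3) by auto
  then have "t \<in> selected \<or> t' \<in> selected" using selected_misses_one[OF m(2)] t by blast
  then show False using t child(2) yz free by blast
qed

lemma sibling_resolved:
  assumes b: "b \<in> V" "b \<notin> skel" and u: "u \<in> desc b"
    and v: "v \<in> desc (par b)" "v \<notin> desc b" and depth: "d r u = d r v" and s: "s \<in> desc b"
  shows "d s u \<noteq> d s v"
proof -
  have br: "b \<noteq> r" using b root_in_skel by auto
  have V: "u \<in> V" "v \<in> V" "s \<in> V" "par b \<in> V" using u v s desc_in_V by auto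
  have "d v s = d v (par b) + 1 + d b s" by (rule gdist_hanging[OF b V(2) v(2) s])
  moreover have "d s u \<le> d s b + d b u" by (rule gdist_triangle[OF V(3) b(1) V(1)])
  moreover have "d (par b) v = d b u + 1"
    using desc_dist[OF v(1)] desc_dist[OF u] par_step(2)[OF b(1) br] depth by simp
  ultimately show ?thesis
    using gdist_sym[OF V(2,3)] gdist_sym[OF V(2,4)] gdist_sym[OF V(3) b(1)] by simp
qed

lemma selected_landmarks_resolving:
  assumes "cotree \<noteq> {} \<or> degree E r = 1"
  shows "resolving_set V E (selected \<union> landmarks)"
proof -
  have False if uv: "u \<in> V" "v \<in> V" "u \<noteq> v" and
    same: "\<And>s. s \<in> selected \<union> landmarks \<Longrightarrow> d s u = d s v" for u v
  proof -
    obtain i where i: "(par ^^ i) u \<in> skel" "\<And>j. j < i \<Longrightarrow> (par ^^ j) u \<notin> skel"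
      "\<And>x. x \<in> skel \<Longrightarrow> d x u = d x ((par ^^ i) u) + i"
      using attachment[OF uv(1)] by metis
    obtain i' where i': "(par ^^ i') v \<in> skel" "\<And>j. j < i' \<Longrightarrow> (par ^^ j) v \<notin> skel"
      "\<And>x. x \<in> skel \<Longrightarrow> d x v = d x ((par ^^ i') v) + i'"
      using attachment[OF uv(2)] by metis
    have top: "(par ^^ i) u = (par ^^ i') v"
    proof (rule landmarks_doubly_resolve[OF i(1) i'(1)])
      fix x assume x: "x \<in> landmarks"
      then have "x \<in> skel" using landmarks_subset by blast
      then show "d x ((par ^^ i) u) + i = d x ((par ^^ i') v) + i'"
        using i(3) i'(3) same x by (metis UnCI)
    qed
    have depth: "d r u = d r v" using same by (simp add: landmarks_def)
    have "i = i'" using top i(3)[OF root_in_skel] i'(3)[OF root_in_skel] depth by simp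
    define k where "k = (LEAST k. (par ^^ k) u = (par ^^ k) v)"
    have k: "(par ^^ k) u = (par ^^ k) v"
      unfolding k_def by (rule LeastI[of _ i]) (use top \<open>i = i'\<close> in simp)
    have "k \<le> i" unfolding k_def by (rule Least_le) (use top \<open>i = i'\<close> in simp)
    have "k \<noteq> 0" using k uv(3) by (cases k) auto
    then obtain j where j: "k = Suc j" using not0_implies_Suc by blast
    define b b' where "b = (par ^^ j) u" and "b' = (par ^^ j) v"
    have bb: "b \<noteq> b'"
      using not_less_Least[of j "\<lambda>k. (par ^^ k) u = (par ^^ k) v"] j unfolding b_def b'_def k_def by simp
    have V: "b \<in> V" "b' \<in> V" using funpow_par_in_V uv by (auto simp: b_def b'_def)
    have ns: "b \<notin> skel" "b' \<notin> skel"
      using i(2)[of j] i'(2)[of j] \<open>k \<le> i\<close> \<open>i = i'\<close> j by (auto simp: b_def b'_def)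
    then have nr: "b \<noteq> r" "b' \<noteq> r" using root_in_skel by auto
    define a where "a = par b"
    have pb: "par b = a" "par b' = a" using k j by (auto simp: a_def b_def b'_def)
    have aV: "a \<in> V" using par_in_V V pb by metis
    have du: "u \<in> desc b" "v \<in> desc b'" using funpow_par_desc uv by (auto simp: b_def b'_def)
    have db: "d r b = d r a + 1" "d r b' = d r a + 1"
      using par_step(2)[OF V(1) nr(1)] par_step(2)[OF V(2) nr(2)] pb by auto
    have nd: "v \<notin> desc b" "u \<notin> desc b'"
      using desc_unique[of v b b'] desc_unique[of u b b'] du db bb by auto
    have da: "u \<in> desc a" "v \<in> desc a"
      using desc_trans[OF du(1) desc_par[OF V(1)]] desc_trans[OF du(2) desc_par[OF V(2)]] pb by auto
    have "d s u \<noteq> d s v" if "s \<in> desc b \<union> desc b'" for s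
      using that sibling_resolved[OF V(1) ns(1) du(1) _ nd(1) depth]
        sibling_resolved[OF V(2) ns(2) du(2) _ nd(2) depth[symmetric]] da pb by fastforce
    then have free: "desc b \<inter> selected = {}" "desc b' \<inter> selected = {}"
      using same by blast+
    have edges: "{a, b} \<in> E" "{a, b'} \<in> E"
      using par_step(1)[OF V(1) nr(1)] par_step(1)[OF V(2) nr(2)] pb by auto
    have "\<exists>c. {a, c} \<in> E \<and> c \<noteq> b \<and> c \<noteq> b'"
    proof (cases "a = r")
      case False
      then have "{a, par a} \<in> E" "d r a = d r (par a) + 1"
        using par_step[OF aV] edge_sym by auto
      moreover from this have "par a \<noteq> b" "par a \<noteq> b'" using db by auto
      ultimately show ?thesis by blast
    next
      case True
      have "degree E r \<noteq> 1" using degree_1_unique[of r b b'] edges True bb by auto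
      then obtain e where e: "e \<in> cotree" using assms by blast
      then have "card e = 2" using edge_card by (auto simp: cotree_def)
      then obtain y where y: "y \<in> e" "y \<noteq> r" by (auto simp: card_2_iff)
      then have ye: "y \<in> ends" and yV: "y \<in> V" using e ends_subset by (auto simp: ends_def)
      define c where "c = (par ^^ (d r y - 1)) y"
      have cV: "c \<in> V" using funpow_par_in_V[OF yV] by (simp add: c_def)
      have "d r y > 0" using depth_0[OF yV] y by simp
      then have dc: "d r c = 1" using depth_funpow_par[OF yV] by (simp add: c_def)
      have "c \<in> skel" using skel_up[OF _ funpow_par_desc[OF yV]] ye ends_in_skel unfolding c_def by blast
      moreover have "c \<noteq> r" using dc root by auto
      moreover have "par c = r"
        using depth_0[OF par_in_V[OF cV]] depth_par[OF cV] dc by simp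
      ultimately show ?thesis using par_step(1)[OF cV] True ns by metis
    qed
    then have "degree E a \<ge> 3" using degree_ge_3[OF edges] bb by metis
    then have major: "a \<in> Maj" using aV by (simp add: major_vertices_def)
    obtain t t' where t: "t \<in> desc b" "t \<in> Ter a" "t' \<in> desc b'" "t' \<in> Ter a"
      using hanging_terminal[OF V(1) ns(1) hanging_no_major[OF V(1) ns(1) free(1)]]
        hanging_terminal[OF V(2) ns(2) hanging_no_major[OF V(2) ns(2) free(2)]] pb by auto
    have "t \<noteq> t'" using desc_unique[of t b b'] t db bb by auto
    then show False using selected_misses_one[OF major t(2,4)] t free by blast
  qed
  then show ?thesis
    unfolding resolving_set_def resolves_def
    using selected_subset landmarks_subset skel_subset by blast
qed

end

section \<open>The upper bound\<close>

context conn_graph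
begin

lemma tree_has_leaf:
  assumes "cycle_rank V E = 0" "u \<in> V" "v \<in> V" "u \<noteq> v"
  obtains r where "r \<in> V" "degree E r = 1"
proof -
  interpret rooted_graph V E u by unfold_locales (rule assms(2))
  have "cotree = {}" using assms(1) cycle_rank_eq by simp
  then have ends: "ends = {}" by (simp add: ends_def)
  obtain m where m: "m \<in> V" "\<And>x. x \<in> V \<Longrightarrow> d u x \<le> d u m"
    using finite_has_max[OF finite_V V_nonempty, of "d u"] by metis
  have "m \<noteq> u" using m(2)[OF assms(3)] gdist_eq_0[OF assms(2,3)] assms(2,4) by auto
  then have "degree E m = 1"
    by (rule childless_degree[OF m(1)]) (use ends m(2) par_step(2) in force)+
  then show thesis using that m(1) by blast
qed

lemma resolving_set_rooted:
  assumes "r \<in> V" "cycle_rank V E \<noteq> 0 \<or> degree E r = 1"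
  obtains X where "r \<in> X" "resolving_set V E (selected \<union> X)" "int (card X) \<le> 1 + 4 * cycle_rank V E"
proof -
  interpret rooted_graph V E r by unfold_locales (rule assms(1))
  have "resolving_set V E (selected \<union> landmarks)"
    by (rule selected_landmarks_resolving) (use assms(2) cycle_rank_eq in auto)
  moreover have "int (card landmarks) \<le> 1 + 4 * cycle_rank V E"
    using card_landmarks cycle_rank_eq by simp
  ultimately show thesis using that[of landmarks] by (simp add: landmarks_def)
qed

lemma cycle_rank_nonneg: "cycle_rank V E \<ge> 0"
proof -
  obtain r where "r \<in> V" using V_nonempty by blast
  then interpret rooted_graph V E r by unfold_locales
  show ?thesis by (simp add: cycle_rank_eq)
qed

lemma metric_dim_tree:
  assumes rank: "cycle_rank V E = 0" and no_path: "\<not> (\<exists>n\<ge>1. path_graph n V E)"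
  shows "metric_dim V E + ex V E \<le> sigma V E"
proof (cases "\<exists>u\<in>V. \<exists>v\<in>V. u \<noteq> v")
  case False
  then have "resolving_set V E {}" by (auto simp: resolving_set_def)
  then have "metric_dim V E \<le> 0" using metric_dim_le by fastforce
  then show ?thesis using card_selected by simp
next
  case True
  then obtain u v where uv: "u \<in> V" "v \<in> V" "u \<noteq> v" by blast
  have "\<exists>X. r \<in> X \<and> resolving_set V E (selected \<union> X) \<and> card X \<le> 1" if "r \<in> V" "degree E r = 1" for r
    using resolving_set_rooted[of r] that rank by (metis add.right_neutral mult_zero_right of_nat_1 of_nat_le_iff)
  moreover have "X = {r}" if "r \<in> X" "card X \<le> 1" "resolving_set V E (selected \<union> X)" for X r
  proof -
    have "finite X" using that(3) finite_V by (auto simp: resolving_set_def intro: finite_subset)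
    then show ?thesis using that(1,2) card_le_Suc0_iff_eq[of X] by auto
  qed
  ultimately have res: "resolving_set V E (insert r selected)" if "r \<in> V" "degree E r = 1" for r
    using that by (metis Un_commute insert_is_Un)
  show ?thesis
  proof (cases "selected = {}")
    case True
    obtain r where "r \<in> V" "degree E r = 1" using tree_has_leaf[OF rank uv] .
    then have "path_graph (card V - 1) V E"
      using res True resolving_singleton_imp_path by metis
    moreover have "card V - 1 \<ge> 1"
      using card_mono[OF finite_V, of "{u, v}"] uv by simp
    ultimately show ?thesis using no_path by blast
  next
    case False
    then obtain r where r: "r \<in> selected" by blast
    then have "resolving_set V E selected"
      using res selected_subset selected_degree by (metis insert_absorb subsetD)
    then show ?thesis using metric_dim_le card_selected by fastforce
  qed
qed

lemma metric_dim_le_L: "int (metric_dim V E) \<le> L V E + 6 * cycle_rank V E"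
proof (cases "\<exists>n\<ge>1. path_graph n V E")
  case True
  then obtain r where "resolving_set V E {r}" using path_graph_resolving by blast
  then have "metric_dim V E \<le> 1" using metric_dim_le by fastforce
  then show ?thesis using True cycle_rank_nonneg by (simp add: L_def)
next
  case no_path: False
  then have L: "L V E = int (sigma V E) - int (ex V E)" unfolding L_def by (rule if_not_P)
  show ?thesis
  proof (cases "cycle_rank V E = 0")
    case True
    then show ?thesis using metric_dim_tree[OF True no_path] L by simp
  next
    case False
    obtain r where "r \<in> V" using V_nonempty by blast
    then obtain X where X: "resolving_set V E (selected \<union> X)" "int (card X) \<le> 1 + 4 * cycle_rank V E"
      using resolving_set_rooted False by metis
    have "metric_dim V E \<le> card selected + card X"
      using metric_dim_le[OF X(1)] card_Un_le le_trans by blast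
    then show ?thesis using card_selected X(2) L cycle_rank_nonneg False by simp
  qed
qed

end

theorem theorem1:
  fixes V :: "'a set" and E :: "'a set set"
  assumes "simple_graph V E" and "connected_graph V E"
  shows "L V E \<le> int (metric_dim V E) \<and> int (metric_dim V E) \<le> L V E + 6 * cycle_rank V E"
proof -
  interpret conn_graph V E by unfold_locales (rule assms)+
  show ?thesis using L_le_metric_dim metric_dim_le_L by blast
qed

end
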